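(* Let $G$ be a graph with $n$ vertices. Then the adjacency spectrum of $G$ can be recovered from its $q$-spectrum by taking the limit of $(\lambda-1)/q$ as $q\to0$. That is, if $\lambda_1(q)\ge\dots\ge\lambda_n(q)$ are the eigenvalues of the similarity matrix $Z(q)$ of $G$ (with multiplicity) for $q\in(0,1)$, and $\alpha_1\ge\dots\ge\alpha_n$ are the eigenvalues of the adjacency matrix of $G$ (with multiplicity), then $\lim_{q\to0^+}(\lambda_i(q)-1)/q=\alpha_i$ for every $i$.
   Context: Graphs are finite, connected, undirected and simple. The vertex set $\{x_1,\dots,x_n\}$ of a graph is regarded as a finite metric space with $d_{ij}=d(x_i,x_j)$ the length of a shortest path between $x_i$ and $x_j$. The similarity matrix is $Z(q)=(q^{d_{ij}})_{i,j}$ and the $q$-spectrum is the multiset of its eigenvalues. The adjacency matrix has $(i,j)$-entry $1$ if $x_i$ and $x_j$ are adjacent and $0$ otherwise; the adjacency spectrum is the multiset of its eigenvalues. *)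

theory Defs
  imports
    Complex_Main
    "Graph_Theory.Digraph_Component"
    "Jordan_Normal_Form.Char_Poly"
    "Jordan_Normal_Form.Conjugate"
begin

text \<open>
  Finite simple undirected graphs are the locale \<^locale>\<open>graph\<close> of the Graph-Theory library:
  finite loop-free digraphs without parallel arcs whose arc relation is symmetric, so that each
  edge is represented by a pair of opposite arcs.
\<close>

text \<open>If there is no path from \<open>u\<close> to \<open>v\<close> the value is unspecified; in a connected graph
  this does not occur.\<close>

definition graph_dist :: "('a, 'b) pre_digraph \<Rightarrow> 'a \<Rightarrow> 'a \<Rightarrow> nat" where
  "graph_dist G u v = (LEAST k. \<exists>p. pre_digraph.apath G u p v \<and> length p = k)"

text \<open>The matrices depend on an enumeration \<open>x 0, \<dots>, x (n - 1)\<close> of the vertices.\<close>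

definition similarity_matrix ::
    "('a, 'b) pre_digraph \<Rightarrow> nat \<Rightarrow> (nat \<Rightarrow> 'a) \<Rightarrow> real \<Rightarrow> real mat" where
  "similarity_matrix G n x q = mat n n (\<lambda>(i, j). q ^ graph_dist G (x i) (x j))"

definition adjacency_matrix ::
    "('a, 'b) pre_digraph \<Rightarrow> nat \<Rightarrow> (nat \<Rightarrow> 'a) \<Rightarrow> real mat" where
  "adjacency_matrix G n x = mat n n (\<lambda>(i, j). if x i \<rightarrow>\<^bsub>G\<^esub> x j then 1 else 0)"

text \<open>The multiset of real eigenvalues with algebraic multiplicity. For a symmetric matrix this is
  the whole spectrum (\<open>size_spectrum_mset\<close> below), and algebraic and geometric
  multiplicities coincide.\<close>

definition spectrum_mset :: "real mat \<Rightarrow> real multiset" where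
  "spectrum_mset A = proots (char_poly A)"

text \<open>Entry \<open>i\<close> of this list is the \<open>(i+1)\<close>-st largest eigenvalue.\<close>

definition eigenvalues_desc :: "real mat \<Rightarrow> real list" where
  "eigenvalues_desc A = rev (sorted_list_of_multiset (spectrum_mset A))"

lemma symmetric_eigenvalue_real:
  fixes A :: "real mat"
  assumes A: "A \<in> carrier_mat n n" and sym: "transpose_mat A = A"
    and ev: "eigenvalue (map_mat complex_of_real A) a"
  shows "a \<in> \<real>"
proof -
  let ?B = "map_mat complex_of_real A"
  have B: "?B \<in> carrier_mat n n" using A by simp
  have symB: "transpose_mat ?B = ?B"
  proof (rule eq_matI)
    fix i j assume ij: "i < dim_row ?B" "j < dim_col ?B"
    hence "transpose_mat A $$ (i, j) = A $$ (j, i)" using A by simp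
    thus "transpose_mat ?B $$ (i, j) = ?B $$ (i, j)" using A ij sym by simp
  qed (use A in auto)
  from ev B obtain v where v: "v \<in> carrier_vec n" "v \<noteq> 0\<^sub>v n" "?B *\<^sub>v v = a \<cdot>\<^sub>v v"
    unfolding eigenvalue_def eigenvector_def by auto
  let ?c = "conjugate v"
  have c: "?c \<in> carrier_vec n" using v by simp
  have conjB: "?B *\<^sub>v ?c = conjugate (?B *\<^sub>v v)"
  proof (rule eq_vecI)
    fix i assume "i < dim_vec (conjugate (?B *\<^sub>v v))"
    hence i: "i < n" using A by simp
    have "conjugate (row ?B i) = row ?B i"
      using A i by (intro eq_vecI) auto
    hence "(?B *\<^sub>v ?c) $ i = conjugate (row ?B i) \<bullet> ?c"
      using A i by simp
    also have "\<dots> = conjugate (row ?B i \<bullet> v)"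
      by (rule conjugate_sprod_vec[symmetric, of _ n]) (use A i v in auto)
    finally show "(?B *\<^sub>v ?c) $ i = conjugate (?B *\<^sub>v v) $ i"
      using A i by simp
  qed simp
  have "a * (v \<bullet> ?c) = (?B *\<^sub>v v) \<bullet> ?c"
    using v c by simp
  also have "\<dots> = v \<bullet> (?B *\<^sub>v ?c)"
    using transpose_vec_mult_scalar[OF B c v(1)] symB by simp
  also have "\<dots> = cnj a * (v \<bullet> ?c)"
    using v c by (simp add: conjB conjugate_smult_vec)
  finally have "a * (v \<bullet> ?c) = cnj a * (v \<bullet> ?c)" .
  moreover have "v \<bullet> ?c \<noteq> 0"
    using v conjugate_square_eq_0_vec[OF v(1)] by auto
  ultimately have "cnj a = a" by simp
  thus ?thesis by (simp add: Reals_cnj_iff)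
qed

lemma size_spectrum_mset:
  assumes A: "A \<in> carrier_mat n n" and sym: "transpose_mat A = A"
  shows "size (spectrum_mset A) = n"
proof -
  let ?B = "map_mat complex_of_real A"
  have B: "?B \<in> carrier_mat n n" using A by simp
  obtain as where as: "char_poly ?B = (\<Prod>a\<leftarrow>as. [:- a, 1:])" "length as = n"
    using char_poly_factorized[OF B] by blast
  have re: "complex_of_real (Re a) = a" if "a \<in> set as" for a
  proof -
    have "poly (char_poly ?B) a = 0"
      using that by (auto simp: as poly_prod_list prod_list_zero_iff)
    hence "eigenvalue ?B a" using eigenvalue_root_char_poly[OF B] by simp
    from symmetric_eigenvalue_real[OF A sym this] show ?thesis by simp
  qed
  interpret h: map_poly_inj_comm_ring_hom complex_of_real ..
  have "map_poly complex_of_real (\<Prod>a\<leftarrow>as. [:- Re a, 1:]) = (\<Prod>a\<leftarrow>as. [:- a, 1:])"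
    using re
  proof (induction as)
    case (Cons b bs)
    have "map_poly complex_of_real ([:- Re b, 1:] * (\<Prod>a\<leftarrow>bs. [:- Re a, 1:]))
        = map_poly complex_of_real [:- Re b, 1:] * (\<Prod>a\<leftarrow>bs. [:- a, 1:])"
      using Cons by (subst h.hom_mult) simp
    also have "map_poly complex_of_real [:- Re b, 1:] = [:- b, 1:]"
      using Cons.prems[of b] by simp
    finally show ?case by (simp only: list.map prod_list.Cons)
  qed simp
  also have "\<dots> = map_poly complex_of_real (char_poly A)"
    using as of_real_hom.char_poly_hom[OF A] by metis
  finally have "char_poly A = (\<Prod>a\<leftarrow>as. [:- Re a, 1:])" by simp
  moreover have "size (proots (\<Prod>a\<leftarrow>bs. [:- Re a, 1:])) = length bs" for bs
  proof (induction bs)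
    case (Cons b bs)
    have "(\<Prod>a\<leftarrow>bs. [:- Re a, 1:]) \<noteq> 0" by (auto simp: prod_list_zero_iff)
    hence "proots ([:- Re b, 1:] * (\<Prod>a\<leftarrow>bs. [:- Re a, 1:]))
        = {#Re b#} + proots (\<Prod>a\<leftarrow>bs. [:- Re a, 1:])"
      by (subst proots_mult) auto
    thus ?case by (simp only: list.map prod_list.Cons Cons.IH size_union size_single list.size)
  qed simp
  ultimately show ?thesis using as by (simp add: spectrum_mset_def)
qed

lemma length_eigenvalues_desc:
  assumes "A \<in> carrier_mat n n" "transpose_mat A = A"
  shows "length (eigenvalues_desc A) = n"
  using size_spectrum_mset[OF assms]
  by (metis eigenvalues_desc_def length_rev mset_sorted_list_of_multiset size_mset)

end

theory Submission
  imports Defs "HOL-Analysis.Elementary_Topology"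
begin

text \<open>
  Write \<open>Z(q) = I + q D(q)\<close>. The graph distance is \<open>0\<close> exactly on the diagonal and \<open>1\<close> exactly on
  adjacent pairs, so \<open>D(q)\<close> tends entrywise to the adjacency matrix, and \<open>(\<lambda>\<^sub>i - 1) / q\<close> is the
  \<open>i\<close>-th eigenvalue of \<open>D(q)\<close>. It remains to see that sorted eigenvalues of symmetric matrices are
  continuous: the characteristic polynomials converge pointwise and the eigenvalues stay bounded,
  so by compactness every cluster point of the eigenvalue vectors is a decreasing enumeration of
  the roots of the limit polynomial, and there is only one such enumeration.
\<close>

section \<open>Dependence of sorted roots on the polynomial\<close>

text \<open>Bolzano-Weierstrass for arbitrary filters, with a finer nontrivial filter in place of a
  subsequence. The coordinates are made convergent one at a time; each refinement preserves the
  limits found earlier.\<close>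

lemma bounded_finite_family_subfilter:
  fixes f :: "'a \<Rightarrow> nat \<Rightarrow> real"
  assumes "F \<noteq> bot" and "eventually (\<lambda>q. \<forall>j<n. \<bar>f q j\<bar> \<le> M) F"
  obtains F' l where "F' \<le> F" "F' \<noteq> bot" "\<And>j. j < n \<Longrightarrow> ((\<lambda>q. f q j) \<longlongrightarrow> l j) F'"
  using assms(2)
proof (induction n arbitrary: thesis)
  case 0
  from 0(1)[OF order.refl assms(1)] show ?case by simp
next
  case (Suc n)
  from Suc.prems(2) have "eventually (\<lambda>q. \<forall>j<n. \<bar>f q j\<bar> \<le> M) F"
    by eventually_elim simp
  then obtain F' l where F': "F' \<le> F" "F' \<noteq> bot"
      "\<And>j. j < n \<Longrightarrow> ((\<lambda>q. f q j) \<longlongrightarrow> l j) F'"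
    using Suc.IH by blast
  have "eventually (\<lambda>q. f q n \<in> {-M..M}) F"
    using Suc.prems(2) by eventually_elim (auto simp: abs_le_iff)
  hence "eventually (\<lambda>q. f q n \<in> {-M..M}) F'"
    using F'(1) filter_leD by blast
  hence "eventually (\<lambda>y. y \<in> {-M..M}) (filtermap (\<lambda>q. f q n) F')"
    by (simp add: eventually_filtermap)
  moreover have "filtermap (\<lambda>q. f q n) F' \<noteq> bot"
    using F'(2) by (simp add: filtermap_bot_iff)
  ultimately obtain y where y: "inf (nhds y) (filtermap (\<lambda>q. f q n) F') \<noteq> bot"
    using compact_Icc[of "-M" M] unfolding compact_filter by meson
  \<comment> \<open>\<open>y\<close> is only a cluster point of \<open>f q n\<close> along
    \<open>F'\<close>. Intersecting \<open>F'\<close> with the preimages of neighbourhoods of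
    \<open>y\<close> turns clustering into convergence, and clustering is what keeps the
    intersection nontrivial.\<close>
  define F'' where "F'' = inf F' (filtercomap (\<lambda>q. f q n) (nhds y))"
  have "F'' \<noteq> bot"
  proof
    assume "F'' = bot"
    hence "eventually (\<lambda>_. False) F''" by simp
    then obtain P Q where PQ: "eventually P F'" "eventually Q (nhds y)"
        "\<And>q. P q \<Longrightarrow> Q (f q n) \<Longrightarrow> False"
      unfolding F''_def eventually_inf eventually_filtercomap by blast
    have "eventually (\<lambda>z. \<not> Q z) (filtermap (\<lambda>q. f q n) F')"
      unfolding eventually_filtermap using PQ(1) by eventually_elim (use PQ(3) in blast)
    with PQ(2) have "eventually (\<lambda>_. False) (inf (nhds y) (filtermap (\<lambda>q. f q n) F'))"
      unfolding eventually_inf by blast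
    with y show False by (simp add: eventually_False)
  qed
  moreover have "F'' \<le> F'" by (simp add: F''_def)
  moreover have "((\<lambda>q. f q n) \<longlongrightarrow> y) F''"
    unfolding F''_def filterlim_def
    by (metis filtermap_mono filtermap_filtercomap inf.cobounded2 order_trans)
  moreover have "((\<lambda>q. f q j) \<longlongrightarrow> l j) F''" if "j < n" for j
    using F'(3)[OF that] \<open>F'' \<le> F'\<close> by (rule tendsto_mono[rotated])
  ultimately show ?case
    using F'(1) by (intro Suc.prems(1)[of F'' "l(n := y)"]) (auto simp: less_Suc_eq)
qed

text \<open>Agreement at every real \<open>t\<close> makes the two polynomials equal, hence also
  their multisets of roots, and a multiset has only one sorted listing. The lists are reversed
  because \<open>sorted\<close> means ascending.\<close>

lemma decreasing_roots_unique:
  fixes a b :: "nat \<Rightarrow> real"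
  assumes "\<And>t. (\<Prod>j<n. t - a j) = (\<Prod>j<n. t - b j)"
    and "antimono_on {..<n} a" and "antimono_on {..<n} b" and "i < n"
  shows "a i = b i"
proof -
  have *: "proots (\<Prod>j<n. [:- c j, 1:]) = mset (map c [0..<n])" for c :: "nat \<Rightarrow> real"
    by (subst proots_prod) (auto simp flip: sum_mset_sum_list simp: sum_unfold_sum_mset atLeast0LessThan image_mset.compositionality o_def)
  have sorted: "sorted (rev (map c [0..<n]))" if "antimono_on {..<n} c" for c :: "nat \<Rightarrow> real"
    using that unfolding sorted_rev_iff_nth_mono by (auto simp: monotone_on_def)
  have "poly (\<Prod>j<n. [:- a j, 1:]) = poly (\<Prod>j<n. [:- b j, 1:])"
    using assms(1) by (auto simp: poly_prod)
  hence "(\<Prod>j<n. [:- a j, 1:]) = (\<Prod>j<n. [:- b j, 1:])"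
    by (simp add: poly_eq_poly_eq_iff)
  hence "mset (map a [0..<n]) = mset (map b [0..<n])"
    by (metis *)
  hence "rev (map a [0..<n]) = rev (map b [0..<n])"
    using sorted[OF assms(2)] sorted[OF assms(3)]
    by (metis mset_rev properties_for_sort sorted_sort_id)
  thus ?thesis
    using assms(4) by auto
qed

lemma tendsto_decreasing_roots:
  fixes a :: "'a \<Rightarrow> nat \<Rightarrow> real" and l :: "nat \<Rightarrow> real"
  assumes conv: "\<And>t. ((\<lambda>q. \<Prod>j<n. t - a q j) \<longlongrightarrow> (\<Prod>j<n. t - l j)) F"
    and bdd: "eventually (\<lambda>q. \<forall>j<n. \<bar>a q j\<bar> \<le> M) F"
    and anti_a: "eventually (\<lambda>q. antimono_on {..<n} (a q)) F"
    and anti_l: "antimono_on {..<n} l" and i: "i < n"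
  shows "((\<lambda>q. a q i) \<longlongrightarrow> l i) F"
proof (rule ccontr)
  assume "\<not> ?thesis"
  then obtain e where e: "e > 0" "\<not> eventually (\<lambda>q. dist (a q i) (l i) < e) F"
    unfolding tendsto_iff by blast
  \<comment> \<open>\<open>F1\<close> restricts \<open>F\<close> to the parameters whose
    \<open>i\<close>-th root stays at distance at least \<open>e\<close> from \<open>l i\<close>.
    Any convergence along a finer nontrivial filter must respect this gap.\<close>
  define F1 where "F1 = inf F (principal {q. \<not> dist (a q i) (l i) < e})"
  have "F1 \<noteq> bot"
    using e(2) unfolding F1_def trivial_limit_def eventually_inf_principal by simp
  moreover have "F1 \<le> F" by (simp add: F1_def)
  ultimately obtain F2 m where F2: "F2 \<le> F1" "F2 \<noteq> bot"
      and m: "\<And>j. j < n \<Longrightarrow> ((\<lambda>q. a q j) \<longlongrightarrow> m j) F2"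
    using bounded_finite_family_subfilter[OF _ filter_leD[OF _ bdd]] by metis
  have le: "F2 \<le> F" using \<open>F1 \<le> F\<close> F2(1) by simp
  \<comment> \<open>Both sides are limits of the same products along \<open>F2\<close>: one by
    hypothesis, the other by convergence of each root.\<close>
  have "(\<Prod>j<n. t - l j) = (\<Prod>j<n. t - m j)" for t
  proof (rule tendsto_unique[OF F2(2)])
    show "((\<lambda>q. \<Prod>j<n. t - a q j) \<longlongrightarrow> (\<Prod>j<n. t - l j)) F2"
      using conv le by (rule tendsto_mono[rotated])
    show "((\<lambda>q. \<Prod>j<n. t - a q j) \<longlongrightarrow> (\<Prod>j<n. t - m j)) F2"
      using m by (intro tendsto_prod tendsto_diff tendsto_const) auto
  qed
  moreover have "antimono_on {..<n} m"
  proof (rule monotone_onI)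
    fix j k assume jk: "j \<in> {..<n}" "k \<in> {..<n}" "j \<le> k"
    have "eventually (\<lambda>q. a q k \<le> a q j) F2"
      using filter_leD[OF le anti_a] by eventually_elim (use jk in \<open>auto simp: monotone_on_def\<close>)
    thus "m k \<le> m j"
      using tendsto_le[OF F2(2) m m] jk by auto
  qed
  ultimately have "l i = m i"
    using decreasing_roots_unique anti_l i by blast
  with m[OF i] e(1) have "eventually (\<lambda>q. dist (a q i) (l i) < e) F2"
    by (auto dest: tendstoD)
  moreover have "eventually (\<lambda>q. \<not> dist (a q i) (l i) < e) F2"
    using F2(1) by (rule filter_leD) (simp add: F1_def eventually_inf_principal)
  ultimately have "eventually (\<lambda>_. False) F2"
    by eventually_elim simp
  with F2(2) show False by (simp add: eventually_False)
qed

section \<open>Eigenvalues of symmetric matrices\<close>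

text \<open>Splitting off one root lowers both the degree and the number of roots by one, so the
  counting hypothesis survives the induction and no algebraic closedness is required.\<close>

lemma poly_eq_prod_proots:
  fixes p :: "'a :: idom poly"
  assumes "size (proots p) = degree p"
  shows "p = Polynomial.smult (lead_coeff p) (\<Prod>x\<in>#proots p. [:- x, 1:])"
  using assms
proof (induction "degree p" arbitrary: p)
  case 0
  then obtain c where "p = [:c:]" by (metis degree_eq_zeroE)
  thus ?case by simp
next
  case (Suc k)
  hence p: "p \<noteq> 0" by auto
  from Suc have "proots p \<noteq> {#}" by auto
  then obtain x where "x \<in># proots p" by blast
  with p have "poly p x = 0" by simp
  then obtain r where r: "p = [:- x, 1:] * r" by (auto simp: poly_eq_0_iff_dvd)
  with p have r0: "r \<noteq> 0" by auto
  have pr: "proots p = add_mset x (proots r)"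
    unfolding r using r0 by (subst proots_mult) auto
  have deg: "degree p = Suc (degree r)"
    unfolding r using r0 by (subst degree_mult_eq) auto
  let ?P = "\<Prod>y\<in>#proots r. [:- y, 1:]"
  have "lead_coeff p = lead_coeff r"
    unfolding r by (simp only: lead_coeff_mult) simp
  moreover have "[:- x, 1:] * r = [:- x, 1:] * Polynomial.smult (lead_coeff r) ?P"
  proof (rule arg_cong[of r])
    have "k = degree r" using Suc.hyps(2) deg by linarith
    moreover have "size (proots r) = degree r"
      using Suc.prems unfolding pr deg by simp
    ultimately show "r = Polynomial.smult (lead_coeff r) ?P" by (rule Suc.hyps(1))
  qed
  moreover have "\<dots> = Polynomial.smult (lead_coeff r) ([:- x, 1:] * ?P)"
    by (rule mult_smult_right)
  moreover have "(\<Prod>y\<in>#proots p. [:- y, 1:]) = [:- x, 1:] * ?P"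
    by (simp only: pr image_mset_add_mset prod_mset.add_mset)
  ultimately show ?case using r by argo
qed

text \<open>A symmetric real matrix has as many real eigenvalues as its monic characteristic
  polynomial has degree, so that polynomial splits over the reals.\<close>

lemma poly_char_poly_eigenvalues_desc:
  assumes A: "A \<in> carrier_mat n n" and sym: "transpose_mat A = A"
  shows "poly (char_poly A) t = (\<Prod>j<n. t - eigenvalues_desc A ! j)"
proof -
  let ?xs = "eigenvalues_desc A"
  have mset: "mset ?xs = proots (char_poly A)"
    by (simp add: eigenvalues_desc_def spectrum_mset_def)
  have "char_poly A = (\<Prod>x\<in>#proots (char_poly A). [:- x, 1:])"
    using poly_eq_prod_proots[of "char_poly A"] size_spectrum_mset[OF A sym]
      degree_monic_char_poly[OF A] by (simp add: spectrum_mset_def)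
  also have "\<dots> = (\<Prod>x\<leftarrow>?xs. [:- x, 1:])"
    by (metis mset mset_map prod_mset_prod_list)
  finally have "poly (char_poly A) t = (\<Prod>x\<leftarrow>?xs. t - x)"
    by (simp add: poly_prod_list o_def)
  also have "\<dots> = (\<Prod>j<n. t - ?xs ! j)"
    using length_eigenvalues_desc[OF A sym]
    by (simp add: prod.list_conv_set_nth atLeast0LessThan)
  finally show ?thesis .
qed

lemma antimono_on_eigenvalues_desc:
  assumes "A \<in> carrier_mat n n" and "transpose_mat A = A"
  shows "antimono_on {..<n} ((!) (eigenvalues_desc A))"
proof -
  have "sorted (rev (eigenvalues_desc A))" by (simp add: eigenvalues_desc_def)
  thus ?thesis
    unfolding sorted_rev_iff_nth_mono using length_eigenvalues_desc[OF assms]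
    by (auto simp: monotone_on_def)
qed

text \<open>An increasing affine map preserves the order of the eigenvalues, so positions match;
  this is where \<open>c > 0\<close> matters. It will be applied with \<open>c = q\<close> and
  \<open>d = 1\<close>.\<close>

lemma eigenvalues_desc_affine:
  assumes A: "A \<in> carrier_mat n n" and sym: "transpose_mat A = A" and c: "c > 0" and i: "i < n"
  shows "eigenvalues_desc (c \<cdot>\<^sub>m A + d \<cdot>\<^sub>m 1\<^sub>m n) ! i = c * eigenvalues_desc A ! i + d"
proof (rule decreasing_roots_unique[OF _ _ _ i])
  let ?B = "c \<cdot>\<^sub>m A + d \<cdot>\<^sub>m 1\<^sub>m n"
  have B: "?B \<in> carrier_mat n n" using A by simp
  have A_sym: "A $$ (j, k) = A $$ (k, j)" if "j < n" "k < n" for j k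
    by (metis A sym that carrier_matD index_transpose_mat(1))
  have symB: "transpose_mat ?B = ?B"
    by (rule eq_matI) (use A A_sym in auto)
  show "antimono_on {..<n} ((!) (eigenvalues_desc ?B))"
    by (rule antimono_on_eigenvalues_desc[OF B symB])
  show "antimono_on {..<n} (\<lambda>i. c * eigenvalues_desc A ! i + d)"
    using antimono_on_eigenvalues_desc[OF A sym] c by (auto simp: monotone_on_def)
  fix t
  \<comment> \<open>This is tI - (cA + dI) = c (((t - d)/c) I - A); taking determinants extracts the
    factor \<open>c ^ n\<close>.\<close>
  have "- char_matrix ?B t = c \<cdot>\<^sub>m (- char_matrix A ((t - d) / c))"
    by (rule eq_matI) (use A c in \<open>auto simp: char_matrix_def field_simps\<close>)
  hence "poly (char_poly ?B) t = c ^ n * poly (char_poly A) ((t - d) / c)"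
    using A by (simp add: char_poly_matrix[OF A] char_poly_matrix[OF B] char_matrix_def)
  also have "\<dots> = (\<Prod>j<n. c * ((t - d) / c - eigenvalues_desc A ! j))"
    by (simp add: poly_char_poly_eigenvalues_desc[OF A sym] prod.distrib)
  also have "\<dots> = (\<Prod>j<n. t - (c * eigenvalues_desc A ! j + d))"
    using c by (intro prod.cong) (auto simp: field_simps)
  finally show "(\<Prod>j<n. t - eigenvalues_desc ?B ! j) = (\<Prod>j<n. t - (c * eigenvalues_desc A ! j + d))"
    by (simp add: poly_char_poly_eigenvalues_desc[OF B symB])
qed

text \<open>Read the eigenvector equation at a coordinate of largest absolute value: that coordinate
  dominates all others and can be cancelled. The bound supplies the compactness needed for the
  continuity of eigenvalues.\<close>

lemma eigenvalue_le_entry_bound: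
  fixes A :: "real mat"
  assumes A: "A \<in> carrier_mat n n" and ev: "eigenvalue A k"
    and M: "\<And>i j. i < n \<Longrightarrow> j < n \<Longrightarrow> \<bar>A $$ (i, j)\<bar> \<le> M"
  shows "\<bar>k\<bar> \<le> real n * M"
proof -
  from ev A obtain v where v: "v \<in> carrier_vec n" "v \<noteq> 0\<^sub>v n" "A *\<^sub>v v = k \<cdot>\<^sub>v v"
    unfolding eigenvalue_def eigenvector_def by auto
  from v(1,2) obtain j where j: "j < n" "v $ j \<noteq> 0" by force
  let ?N = "(\<lambda>j. \<bar>v $ j\<bar>) ` {..<n}"
  have "Max ?N \<in> ?N" using j(1) by (intro Max_in) auto
  moreover have "\<bar>v $ j\<bar> \<le> Max ?N" if "j < n" for j using that by simp
  ultimately obtain i where i: "i < n" and max: "\<And>j. j < n \<Longrightarrow> \<bar>v $ j\<bar> \<le> \<bar>v $ i\<bar>"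
    by (metis (no_types, lifting) imageE lessThan_iff)
  have vi: "\<bar>v $ i\<bar> > 0" using max[OF j(1)] j(2) by linarith
  have "k * v $ i = (A *\<^sub>v v) $ i" using v i by simp
  also have "\<dots> = (\<Sum>j<n. A $$ (i, j) * v $ j)"
    using A v(1) i by (auto simp: scalar_prod_def atLeast0LessThan)
  finally have "\<bar>k\<bar> * \<bar>v $ i\<bar> = \<bar>\<Sum>j<n. A $$ (i, j) * v $ j\<bar>"
    by (simp flip: abs_mult)
  also have "\<dots> \<le> (\<Sum>j<n. \<bar>A $$ (i, j) * v $ j\<bar>)" by (rule sum_abs)
  also have "\<dots> \<le> (\<Sum>j<n. M * \<bar>v $ i\<bar>)"
    unfolding abs_mult
  proof (rule sum_mono)
    fix j assume "j \<in> {..<n}"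
    thus "\<bar>A $$ (i, j)\<bar> * \<bar>v $ j\<bar> \<le> M * \<bar>v $ i\<bar>"
      using M[OF i, of j] max[of j] by (intro mult_mono) auto
  qed
  also have "\<dots> = real n * M * \<bar>v $ i\<bar>" by simp
  finally show ?thesis using vi by simp
qed

text \<open>By the Leibniz formula the determinant is a finite sum of finite products of
  entries.\<close>

lemma tendsto_det:
  fixes A :: "'a \<Rightarrow> 'b :: {real_normed_field} mat"
  assumes "\<And>q. A q \<in> carrier_mat n n" and "L \<in> carrier_mat n n"
    and "\<And>i j. i < n \<Longrightarrow> j < n \<Longrightarrow> ((\<lambda>q. A q $$ (i, j)) \<longlongrightarrow> L $$ (i, j)) F"
  shows "((\<lambda>q. det (A q)) \<longlongrightarrow> det L) F"
  unfolding det_def'[OF assms(1)] det_def'[OF assms(2)]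
proof (intro tendsto_sum tendsto_mult tendsto_const tendsto_prod)
  fix p i assume "p \<in> {p. p permutes {0..<n}}" and "i \<in> {0..<n}"
  thus "((\<lambda>q. A q $$ (i, p i)) \<longlongrightarrow> L $$ (i, p i)) F"
    using assms(3)[of i "p i"] permutes_in_image[of p "{0..<n}" i] by simp
qed

text \<open>Entrywise convergence gives an eventual bound on the eigenvalues and, through
  determinants, pointwise convergence of the characteristic polynomials, as
  \<open>tendsto_decreasing_roots\<close> demands.\<close>

lemma tendsto_eigenvalues_desc:
  assumes A: "\<And>q. A q \<in> carrier_mat n n" "\<And>q. transpose_mat (A q) = A q"
    and L: "L \<in> carrier_mat n n" "transpose_mat L = L"
    and lim: "\<And>i j. i < n \<Longrightarrow> j < n \<Longrightarrow> ((\<lambda>q. A q $$ (i, j)) \<longlongrightarrow> L $$ (i, j)) F"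
    and i: "i < n"
  shows "((\<lambda>q. eigenvalues_desc (A q) ! i) \<longlongrightarrow> eigenvalues_desc L ! i) F"
proof -
  let ?S = "{..<n} \<times> {..<n}"
  \<comment> \<open>The added 1 makes the bound on the entries of \<open>L\<close> strict, so that
    it passes to the entries of \<open>A q\<close> eventually.\<close>
  define M where "M = Max ((\<lambda>ij. \<bar>L $$ ij\<bar> + 1) ` ?S)"
  have M: "\<bar>L $$ ij\<bar> < M" if "ij \<in> ?S" for ij
  proof -
    have "\<bar>L $$ ij\<bar> + 1 \<le> M" unfolding M_def using that by (intro Max_ge) auto
    thus ?thesis by simp
  qed
  have "eventually (\<lambda>q. \<bar>A q $$ ij\<bar> < M) F" if "ij \<in> ?S" for ij
    using that M[OF that] tendsto_rabs[OF lim[of "fst ij" "snd ij"]]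
    by (intro order_tendstoD(2)[of _ "\<bar>L $$ ij\<bar>"]) auto
  hence ev: "eventually (\<lambda>q. \<forall>ij\<in>?S. \<bar>A q $$ ij\<bar> < M) F"
    by (intro eventually_ball_finite) auto
  have bdd: "eventually (\<lambda>q. \<forall>j<n. \<bar>eigenvalues_desc (A q) ! j\<bar> \<le> real n * M) F"
    using ev
  proof eventually_elim
    case (elim q)
    show ?case
    proof (intro allI impI)
      fix j assume j: "j < n"
      have "poly (char_poly (A q)) (eigenvalues_desc (A q) ! j) = 0"
        unfolding poly_char_poly_eigenvalues_desc[OF A] using j by (auto intro: prod_zero)
      hence "eigenvalue (A q) (eigenvalues_desc (A q) ! j)"
        using eigenvalue_root_char_poly[OF A(1)] by simp
      thus "\<bar>eigenvalues_desc (A q) ! j\<bar> \<le> real n * M"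
        using elim by (intro eigenvalue_le_entry_bound[OF A(1)]) (auto intro: less_imp_le)
    qed
  qed
  show ?thesis
  proof (rule tendsto_decreasing_roots[OF _ bdd _ _ i])
    fix t
    have "((\<lambda>q. det (- char_matrix (A q) t)) \<longlongrightarrow> det (- char_matrix L t)) F"
    proof (rule tendsto_det)
      show "((\<lambda>q. (- char_matrix (A q) t) $$ (i, j)) \<longlongrightarrow> (- char_matrix L t) $$ (i, j)) F"
        if "i < n" "j < n" for i j
      proof -
        have "(- char_matrix B t) $$ (i, j) = - (B $$ (i, j) + - t * 1\<^sub>m n $$ (i, j))"
          if "B \<in> carrier_mat n n" for B
          using that \<open>i < n\<close> \<open>j < n\<close> by (simp add: char_matrix_def)
        thus ?thesis
          using A(1) L(1) by (auto intro!: tendsto_intros lim that)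
      qed
    qed (use A L in auto)
    thus "((\<lambda>q. \<Prod>j<n. t - eigenvalues_desc (A q) ! j) \<longlongrightarrow> (\<Prod>j<n. t - eigenvalues_desc L ! j)) F"
      by (simp only: char_poly_matrix[OF A(1), symmetric] char_poly_matrix[OF L(1), symmetric]
          poly_char_poly_eigenvalues_desc[OF A] poly_char_poly_eigenvalues_desc[OF L])
  qed (simp_all add: antimono_on_eigenvalues_desc A L)
qed

section \<open>Graph distance\<close>

text \<open>Each arc is replaced by an opposite one. The clause on \<open>awalk_verts\<close>
  carries distinctness of vertices over to the reversed walk, which paths require.\<close>

lemma (in sym_digraph) awalk_reverse:
  assumes "awalk u p v"
  obtains p' where "awalk v p' u" "length p' = length p"
    "awalk_verts v p' = rev (awalk_verts u p)"
  using assms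
proof (induction p arbitrary: u thesis)
  case Nil
  from Nil(1)[of "[]"] Nil(2) show ?case by (auto simp: awalk_Nil_iff)
next
  case (Cons e es)
  from Cons.prems(2) have e: "e \<in> arcs G" "tail G e = u" and es: "awalk (head G e) es v"
    by (auto simp: awalk_Cons_iff)
  from Cons.IH[OF _ es] obtain p' where p': "awalk v p' (head G e)" "length p' = length es"
      "awalk_verts v p' = rev (awalk_verts (head G e) es)" by blast
  from e(1) obtain e' where e': "e' \<in> arcs G" "tail G e = head G e'" "head G e = tail G e'"
    using sym_arcs unfolding symmetric_conv by blast
  have "awalk (head G e) [e'] u"
    using e e' by (auto simp: awalk_Cons_iff awalk_Nil_iff)
  with p'(1) have w: "awalk v (p' @ [e']) u" by (rule awalk_appendI)
  have "awalk_verts v (p' @ [e']) = rev (awalk_verts u (e # es))"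
    unfolding awalk_verts_append[OF w] using p'(3) e e' by simp
  with w p'(2) show ?case by (intro Cons.prems(1)) auto
qed

lemma (in sym_digraph) apath_reverse:
  assumes "apath u p v"
  obtains p' where "apath v p' u" "length p' = length p"
  using assms unfolding apath_def by (metis awalk_reverse distinct_rev)

lemma (in sym_digraph) graph_dist_commute: "graph_dist G u v = graph_dist G v u"
  unfolding graph_dist_def by (rule arg_cong[of _ _ Least]) (metis apath_reverse)

lemma (in wf_digraph) graph_dist_self: "u \<in> verts G \<Longrightarrow> graph_dist G u u = 0"
  unfolding graph_dist_def by (auto simp: apath_Nil_iff)

text \<open>Reachability makes the set of path lengths nonempty, so the \<open>LEAST\<close> in
  \<open>graph_dist\<close> is attained.\<close>

lemma (in wf_digraph) apath_graph_dist:
  assumes "u \<rightarrow>\<^sup>*\<^bsub>G\<^esub> v"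
  obtains p where "apath u p v" "length p = graph_dist G u v"
proof -
  have "\<exists>k p. apath u p v \<and> length p = k" using assms by (simp add: reachable_apath)
  from LeastI_ex[OF this] show ?thesis using that unfolding graph_dist_def by blast
qed

lemma (in wf_digraph) graph_dist_pos:
  assumes "u \<rightarrow>\<^sup>*\<^bsub>G\<^esub> v" "u \<noteq> v"
  shows "graph_dist G u v > 0"
  using apath_graph_dist[OF assms(1)] assms(2) by (metis apath_Nil_iff length_0_conv not_gr_zero)

text \<open>A path of length 1 is a single arc. Conversely, \<open>u \<noteq> v\<close> makes an arc
  a path with distinct vertices and excludes distance 0.\<close>

lemma (in wf_digraph) graph_dist_eq_1_iff:
  assumes "u \<rightarrow>\<^sup>*\<^bsub>G\<^esub> v" "u \<noteq> v"
  shows "graph_dist G u v = 1 \<longleftrightarrow> u \<rightarrow>\<^bsub>G\<^esub> v"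
proof
  assume "graph_dist G u v = 1"
  then obtain e where "apath u [e] v"
    using apath_graph_dist[OF assms(1)] by (metis One_nat_def length_0_conv length_Suc_conv)
  thus "u \<rightarrow>\<^bsub>G\<^esub> v" by (auto simp: apath_Cons_iff apath_Nil_iff in_arcs_imp_in_arcs_ends)
next
  assume "u \<rightarrow>\<^bsub>G\<^esub> v"
  then obtain e where e: "e \<in> arcs G" "tail G e = u" "head G e = v" by auto
  hence "apath u [e] v" using assms(2) by (auto simp: apath_Cons_iff apath_Nil_iff)
  hence "graph_dist G u v \<le> 1"
    unfolding graph_dist_def by (intro Least_le exI[of _ "[e]"]) auto
  with graph_dist_pos[OF assms] show "graph_dist G u v = 1" by simp
qed

section \<open>Limit of the rescaled similarity spectrum\<close>

theorem proposition2p2: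
  fixes G :: "('a, 'b) pre_digraph" and x :: "nat \<Rightarrow> 'a" and n i :: nat
  assumes "graph G"
    and "Digraph_Component.connected G"
    and "bij_betw x {..<n} (verts G)"
    and "i < n"
  shows "((\<lambda>q. (eigenvalues_desc (similarity_matrix G n x q) ! i - 1) / q)
           \<longlongrightarrow> eigenvalues_desc (adjacency_matrix G n x) ! i) (at_right 0)"
proof -
  interpret graph G by fact
  let ?A = "adjacency_matrix G n x" and ?Z = "similarity_matrix G n x"
  \<comment> \<open>\<open>D q\<close> is symmetric for every real \<open>q\<close>, including 0, as
    the continuity lemma asks; only the identity \<open>Z\<close> below needs
    \<open>q > 0\<close>.\<close>
  define D where "D q = mat n n (\<lambda>(j, k). (?Z q $$ (j, k) - 1\<^sub>m n $$ (j, k)) / q)" for q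
  have x: "x j \<in> verts G" if "j < n" for j
    using assms(3) that by (auto simp: bij_betw_def)
  have x_eq: "x j = x k \<longleftrightarrow> j = k" if "j < n" "k < n" for j k
    using assms(3) that by (auto simp: bij_betw_def inj_on_def)
  \<comment> \<open>\<open>connected\<close> speaks of the symmetric closure of \<open>G\<close>;
    since the arcs are already symmetric, reachability there is reachability in
    \<open>G\<close>.\<close>
  have reach: "x j \<rightarrow>\<^sup>*\<^bsub>G\<^esub> x k" if "j < n" "k < n" for j k
    using assms(2) x that reachable_mk_symmetric_eq[OF sym_arcs]
    by (auto simp: connected_def strongly_connected_def)
  have A: "?A \<in> carrier_mat n n" and D: "D q \<in> carrier_mat n n" for q
    by (simp_all add: adjacency_matrix_def D_def)
  have symA: "transpose_mat ?A = ?A"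
    by (rule eq_matI) (auto simp: adjacency_matrix_def dest: graph_symmetric)
  have symD: "transpose_mat (D q) = D q" for q
    by (rule eq_matI) (auto simp: D_def similarity_matrix_def graph_dist_commute)
  have Z: "?Z q = q \<cdot>\<^sub>m D q + 1 \<cdot>\<^sub>m 1\<^sub>m n" if "q > 0" for q
    by (rule eq_matI) (use that in \<open>auto simp: D_def similarity_matrix_def\<close>)
  have lim: "((\<lambda>q. D q $$ (j, k)) \<longlongrightarrow> ?A $$ (j, k)) (at_right 0)" if jk: "j < n" "k < n" for j k
  proof (cases "j = k")
    case True
    thus ?thesis
      using jk x by (auto simp: D_def similarity_matrix_def adjacency_matrix_def graph_dist_self
          dest: adj_not_same)
  next
    case False
    hence ne: "x j \<noteq> x k" using x_eq jk by simp
    from graph_dist_pos[OF reach[OF jk] ne] obtain d where d: "graph_dist G (x j) (x k) = Suc d"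
      using gr0_implies_Suc by blast
    \<comment> \<open>Off the diagonal the entry of \<open>D q\<close> is
      \<open>q ^ Suc d / q\<close>, that is \<open>q ^ d\<close> for \<open>q > 0\<close>. Its limit
      \<open>0 ^ d\<close> is 1 exactly when \<open>d = 0\<close>, i.e. when the distance is
      1.\<close>
    have "?A $$ (j, k) = 0 ^ d"
      using jk graph_dist_eq_1_iff[OF reach[OF jk] ne] d by (auto simp: adjacency_matrix_def)
    moreover have "((\<lambda>q. q ^ d) \<longlongrightarrow> (0::real) ^ d) (at_right 0)"
      by (intro tendsto_intros)
    moreover have "eventually (\<lambda>q. q ^ d = D q $$ (j, k)) (at_right 0)"
      using eventually_at_right_less
      by eventually_elim (use jk False d in \<open>auto simp: D_def similarity_matrix_def\<close>)
    ultimately show ?thesis using Lim_transform_eventually by fastforce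
  qed
  have "((\<lambda>q. eigenvalues_desc (D q) ! i) \<longlongrightarrow> eigenvalues_desc ?A ! i) (at_right 0)"
    by (rule tendsto_eigenvalues_desc[OF D symD A symA lim \<open>i < n\<close>])
  \<comment> \<open>The one-sided filter supplies \<open>q > 0\<close>, which both \<open>Z\<close>
    and the affine rule for eigenvalues need.\<close>
  moreover have "eventually (\<lambda>q. eigenvalues_desc (D q) ! i = (eigenvalues_desc (?Z q) ! i - 1) / q)
      (at_right 0)"
    using eventually_at_right_less
    by eventually_elim (simp add: Z eigenvalues_desc_affine[OF D symD _ \<open>i < n\<close>])
  ultimately show ?thesis by (rule Lim_transform_eventually)
qed

end
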